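(* There exists a constant $\beta>0$ such that for all sufficiently large $X$, \[ \#\{1\leq n\leq X:\ \sigma moex(n)\text{ is odd}\}\geq \beta\log\log X . \]
   Context: For a partition $\pi$ of a positive integer $n$, $moex(\pi)$ is the smallest odd positive integer that is not a part of $\pi$. For a positive integer $n$, $\sigma moex(n)=\sum_{\pi} moex(\pi)$, summed over all partitions $\pi$ of $n$, and $\sigma moex(0)=1$. Equivalently, $\sum_{n\geq 0}\sigma moex(n)q^n=(-q;q)_\infty(-q;q^2)_\infty^2$, where $(a;q)_\infty=\prod_{m\geq 1}(1-aq^{m-1})$. *)

theory Defs
  imports Complex_Main "HOL-Library.Multiset"
begin

definition partitions_of :: "nat \<Rightarrow> nat multiset set" where
  "partitions_of n = {\<pi>. 0 \<notin># \<pi> \<and> sum_mset \<pi> = n}"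

definition moex :: "nat multiset \<Rightarrow> nat" where
  "moex \<pi> = (LEAST k. odd k \<and> k \<notin># \<pi>)"

definition sigma_moex :: "nat \<Rightarrow> nat" where
  "sigma_moex n = (\<Sum>\<pi>\<in>partitions_of n. moex \<pi>)"

lemma finite_partitions_of: "finite (partitions_of n)"
proof -
  have "partitions_of n \<subseteq> mset ` {xs. set xs \<subseteq> {..n} \<and> length xs \<le> n}"
  proof
    fix \<pi> assume "\<pi> \<in> partitions_of n"
    then have pos: "0 \<notin># \<pi>" and s: "sum_mset \<pi> = n" by (auto simp: partitions_of_def)
    obtain xs where xs: "mset xs = \<pi>" using ex_mset by blast
    have "set xs \<subseteq> {..n}"
      using s xs member_le_sum_list[of _ xs] by (auto simp flip: sum_mset_sum_list)
    moreover have "length ys \<le> sum_list ys" if "0 \<notin> set ys" for ys :: "nat list"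
      using that by (induction ys) auto
    then have "length xs \<le> n"
      using pos s xs by (auto simp flip: sum_mset_sum_list)
    ultimately show "\<pi> \<in> mset ` {xs. set xs \<subseteq> {..n} \<and> length xs \<le> n}"
      using xs by auto
  qed
  then show ?thesis
    by (rule finite_subset) (intro finite_imageI finite_lists_length_le, simp)
qed

lemma moex_correct: "odd (moex \<pi>) \<and> moex \<pi> \<notin># \<pi>"
proof -
  obtain k where "k > Max (insert 0 (set_mset \<pi>))" "odd k"
    by (metis even_Suc less_Suc_eq lessI)
  then have "odd k \<and> k \<notin># \<pi>"
    by (metis Max_ge finite_insert finite_set_mset insertCI leD)
  then show ?thesis unfolding moex_def by (rule LeastI)
qed

lemma sigma_moex_0: "sigma_moex 0 = 1"
proof -
  have "partitions_of 0 = {{#}}"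
    by (auto simp: partitions_of_def sum_mset_0_iff) (metis multiset_nonemptyE)
  moreover have "moex {#} = 1"
    unfolding moex_def by (rule Least_equality) (auto elim: oddE)
  ultimately show ?thesis by (simp add: sigma_moex_def)
qed

end

theory Submission
  imports Defs "HOL-Library.Nat_Bijection" "HOL-Computational_Algebra.Formal_Power_Series"
begin

text \<open>
  Since \<open>moex\<close> only takes odd values, \<open>sigma_moex n\<close> has the parity of the partition number
  \<open>p(n)\<close>. Euler's recurrence \<open>\<Sum>\<^sub>j (-1)\<^sup>j p(N - j(3j+1)/2) = 0\<close>, taken at a generalized pentagonal
  number \<open>N = k(3k+1)/2\<close>, contains the odd term \<open>p(0) = 1\<close>, and the largest pentagonal number
  below \<open>N\<close> is \<open>N - k\<close>. Hence some \<open>p(i)\<close> with \<open>k \<le> i \<le> N\<close> is odd. The intervals obtained from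
  \<open>k = 2^(4^i)\<close> are disjoint, which gives the doubly logarithmic bound. Euler's pentagonal number
  theorem itself follows from a finite identity of Shanks, proved by telescoping.
\<close>

unbundle fps_syntax

section \<open>Partitions with bounded parts\<close>

definition bounded_partitions :: "nat \<Rightarrow> nat \<Rightarrow> nat multiset set" where
  "bounded_partitions k n = {\<pi>. set_mset \<pi> \<subseteq> {1..k} \<and> sum_mset \<pi> = n}"

text \<open>Bounding the parts keeps Euler's product finite, so no convergence is involved; the
  coefficients up to degree \<open>k\<close> are already the partition numbers.\<close>

definition partition_fps :: "nat \<Rightarrow> int fps" where
  "partition_fps k = Abs_fps (\<lambda>n. int (card (bounded_partitions k n)))"

lemma finite_bounded_partitions: "finite (bounded_partitions k n)"
proof (rule finite_subset[OF _ finite_partitions_of[of n]])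
  show "bounded_partitions k n \<subseteq> partitions_of n"
    by (auto simp: bounded_partitions_def partitions_of_def)
qed

lemma bounded_partitions_eq_partitions_of:
  assumes "n \<le> k"
  shows "bounded_partitions k n = partitions_of n"
proof -
  have "x \<le> n" if "x \<in># \<pi>" "sum_mset \<pi> = n" for x and \<pi> :: "nat multiset"
    using that by (auto dest!: multi_member_split)
  then have "set_mset \<pi> \<subseteq> {1..k} \<longleftrightarrow> 0 \<notin># \<pi>" if "sum_mset \<pi> = n" for \<pi> :: "nat multiset"
    using that assms by (auto simp: subset_iff Suc_le_eq intro: order_trans gr0I)
  then show ?thesis
    unfolding bounded_partitions_def partitions_of_def by blast
qed

lemma bounded_partitions_0: "bounded_partitions 0 n = (if n = 0 then {{#}} else {})"
  by (auto simp: bounded_partitions_def)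

text \<open>Split by whether \<open>Suc k\<close> occurs. Removing only one copy may leave others,
  so the second family keeps the bound \<open>Suc k\<close>.\<close>

lemma bounded_partitions_Suc:
  "bounded_partitions (Suc k) n = bounded_partitions k n \<union>
     (if Suc k \<le> n then add_mset (Suc k) ` bounded_partitions (Suc k) (n - Suc k) else {})"
    (is "?L = ?A \<union> ?B")
proof
  show "?L \<subseteq> ?A \<union> ?B"
  proof
    fix \<pi> assume \<pi>: "\<pi> \<in> ?L"
    show "\<pi> \<in> ?A \<union> ?B"
    proof (cases "Suc k \<in># \<pi>")
      case True
      then obtain \<rho> where \<rho>: "\<pi> = add_mset (Suc k) \<rho>"
        by (metis insert_DiffM)
      then have "\<rho> \<in> bounded_partitions (Suc k) (n - Suc k)" "Suc k \<le> n"
        using \<pi> by (auto simp: bounded_partitions_def)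
      then show ?thesis
        using \<rho> by auto
    next
      case False
      have "x \<le> k" if "x \<in># \<pi>" for x
        using that \<pi> False by (metis (no_types, lifting) atLeastAtMost_iff bounded_partitions_def
            le_SucE mem_Collect_eq subsetD)
      then show ?thesis
        using \<pi> by (auto simp: bounded_partitions_def)
    qed
  qed
  show "?A \<union> ?B \<subseteq> ?L"
    by (force simp: bounded_partitions_def split: if_splits)
qed

lemma card_bounded_partitions_Suc:
  "card (bounded_partitions (Suc k) n) = card (bounded_partitions k n) +
     (if Suc k \<le> n then card (bounded_partitions (Suc k) (n - Suc k)) else 0)"
proof -
  let ?B = "add_mset (Suc k) ` bounded_partitions (Suc k) (n - Suc k)"
  have disj: "bounded_partitions k n \<inter> ?B = {}"
  proof -
    have "Suc k \<notin># \<pi>" if "\<pi> \<in> bounded_partitions k n" for \<pi>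
      using that by (auto simp: bounded_partitions_def)
    then show ?thesis
      by fastforce
  qed
  have card_B: "card ?B = card (bounded_partitions (Suc k) (n - Suc k))"
    by (rule card_image) (simp add: inj_on_def)
  show ?thesis
  proof (cases "Suc k \<le> n")
    case True
    then have "bounded_partitions (Suc k) n = bounded_partitions k n \<union> ?B"
      by (subst bounded_partitions_Suc) (rule arg_cong[where f = "(\<union>) _"], rule if_P)
    then show ?thesis
      using True card_B card_Un_disjoint[OF _ _ disj] finite_bounded_partitions by simp
  next
    case False
    then have "bounded_partitions (Suc k) n = bounded_partitions k n"
      by (subst bounded_partitions_Suc) simp
    then show ?thesis
      using False by simp
  qed
qed

lemma partition_fps_0: "partition_fps 0 = 1"
  by (rule fps_ext) (auto simp: partition_fps_def bounded_partitions_0)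

lemma partition_fps_Suc: "partition_fps (Suc k) * (1 - fps_X ^ Suc k) = partition_fps k"
proof (rule fps_ext)
  fix n
  have "(partition_fps (Suc k) * (1 - fps_X ^ Suc k)) $ n =
      partition_fps (Suc k) $ n - (if n < Suc k then 0 else partition_fps (Suc k) $ (n - Suc k))"
    by (simp add: right_diff_distrib fps_X_power_mult_right_nth del: power_Suc)
  then show "(partition_fps (Suc k) * (1 - fps_X ^ Suc k)) $ n = partition_fps k $ n"
    using card_bounded_partitions_Suc[of k n] by (auto simp: partition_fps_def)
qed

lemma partition_fps_times_prod: "partition_fps n * (\<Prod>k=1..n. 1 - fps_X ^ k) = 1"
proof (induction n)
  case 0
  then show ?case by (simp add: partition_fps_0)
next
  case (Suc n)
  have "partition_fps (Suc n) * (\<Prod>k=1..Suc n. 1 - fps_X ^ k) =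
      (partition_fps (Suc n) * (1 - fps_X ^ Suc n)) * (\<Prod>k=1..n. 1 - fps_X ^ k)"
    by (simp add: mult_ac del: power_Suc)
  also have "\<dots> = 1"
    using Suc by (simp only: partition_fps_Suc)
  finally show ?case .
qed

section \<open>Shanks' identity and the pentagonal number recurrence\<close>

text \<open>
  The exponents \<open>j * j + triangle j = j(3j+1)/2\<close> and \<open>j * j + triangle (j - 1) = j(3j-1)/2\<close> are the
  generalized pentagonal numbers, written without division.
\<close>

definition pentagonal_sum :: "nat \<Rightarrow> int fps" where
  "pentagonal_sum n = 1 + (\<Sum>j=1..n. (-1) ^ j *
     (fps_X ^ (j * j + triangle j) + fps_X ^ (j * j + triangle (j - 1))))"

text \<open>In q-notation this is (-1)^s (q)_n / (q)_s q^(sn + s(s+1)/2), the quotient being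
  cancelled to a product. The term \<open>s = 0\<close> is Euler's product (q)_n.\<close>

definition shanks_term :: "nat \<Rightarrow> nat \<Rightarrow> int fps" where
  "shanks_term n s = (-1) ^ s * (\<Prod>k=Suc s..n. 1 - fps_X ^ k) * fps_X ^ (s * n + triangle s)"

lemma shanks_term_Suc:
  assumes "s \<le> n"
  shows "shanks_term (Suc n) s = (1 - fps_X ^ Suc n) * fps_X ^ s * shanks_term n s"
  using assms by (simp add: shanks_term_def power_add mult_ac del: power_Suc)

lemma shanks_term_shift:
  assumes "s < n"
  shows "shanks_term n (Suc s) * (1 - fps_X ^ Suc s) = - (fps_X ^ (Suc n + s) * shanks_term n s)"
proof -
  have "(\<Prod>k=Suc s..n. 1 - fps_X ^ k :: int fps) =
      (1 - fps_X ^ Suc s) * (\<Prod>k=Suc (Suc s)..n. 1 - fps_X ^ k)"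
    using assms by (intro prod.atLeast_Suc_atMost) auto
  moreover have "Suc s * n + triangle (Suc s) = (Suc n + s) + (s * n + triangle s)"
    by simp
  ultimately show ?thesis
    unfolding shanks_term_def by (simp only: power_add power_Suc mult_ac) simp
qed

text \<open>Telescoping: \<open>shanks_term_shift\<close> rewrites the bound for \<open>m\<close> as
  a multiple of the term at \<open>Suc m\<close>, and the contributions with
  \<open>fps_X ^ Suc m\<close> then cancel.\<close>

lemma sum_shanks_term_diff:
  assumes "m \<le> n"
  shows "(\<Sum>s\<le>m. shanks_term (Suc n) s - shanks_term n s) = - (fps_X ^ (Suc n + m) * shanks_term n m)"
  using assms
proof (induction m)
  case 0
  then show ?case
    by (simp add: shanks_term_Suc algebra_simps)
next
  case (Suc m)
  have "(\<Sum>s\<le>Suc m. shanks_term (Suc n) s - shanks_term n s) =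
      shanks_term n (Suc m) * (1 - fps_X ^ Suc m) +
      ((1 - fps_X ^ Suc n) * fps_X ^ Suc m * shanks_term n (Suc m) - shanks_term n (Suc m))"
    using Suc by (simp add: shanks_term_Suc shanks_term_shift del: power_Suc)
  also have "\<dots> = - (fps_X ^ (Suc n + Suc m) * shanks_term n (Suc m))"
    by (simp only: power_add) (simp add: algebra_simps)
  finally show ?case .
qed

text \<open>Passing from n to n+1 creates two new monomials: the boundary of the telescoped
  differences gives the exponent with \<open>triangle n\<close>, the new last term the one with
  \<open>triangle (Suc n)\<close>.\<close>

lemma shanks_identity: "(\<Sum>s\<le>n. shanks_term n s) = pentagonal_sum n"
proof (induction n)
  case 0
  then show ?case
    by (simp add: shanks_term_def pentagonal_sum_def)
next
  case (Suc n)
  have "(\<Sum>s\<le>Suc n. shanks_term (Suc n) s) =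
      (\<Sum>s\<le>n. shanks_term n s) + (\<Sum>s\<le>n. shanks_term (Suc n) s - shanks_term n s)
        + shanks_term (Suc n) (Suc n)"
    by (simp add: sum_subtractf)
  also have "\<dots> = pentagonal_sum n - fps_X ^ (Suc n + n) * shanks_term n n
      + shanks_term (Suc n) (Suc n)"
    using Suc sum_shanks_term_diff[of n n] by simp
  also have "\<dots> = pentagonal_sum n + (-1) ^ Suc n * (fps_X ^ (Suc n * Suc n + triangle (Suc n))
      + fps_X ^ (Suc n * Suc n + triangle n))"
  proof -
    have "fps_X ^ (Suc n + n) * shanks_term n n = (-1) ^ n * fps_X ^ (Suc n * Suc n + triangle n)"
      by (simp add: shanks_term_def mult_ac flip: power_add power_Suc)
    then show ?thesis
      by (simp add: shanks_term_def algebra_simps)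
  qed
  also have "\<dots> = pentagonal_sum (Suc n)"
    by (simp add: pentagonal_sum_def)
  finally show ?case .
qed

text \<open>Modulo \<open>fps_X ^ Suc n\<close> only the Shanks term \<open>s = 0\<close> survives,
  so up to degree n \<open>pentagonal_sum n\<close> inverts \<open>partition_fps n\<close>; compare
  the coefficients at n.\<close>

lemma pentagonal_recurrence:
  assumes "n > 0"
  shows "(\<Sum>i\<le>n. int (card (partitions_of i)) * pentagonal_sum n $ (n - i)) = 0"
proof -
  have "fps_X ^ Suc n dvd shanks_term n s" if "s \<in> {1..n}" for s
  proof -
    have "Suc n \<le> s * n + triangle s"
      using that by (cases s) auto
    then show ?thesis
      unfolding shanks_term_def by (intro dvd_mult le_imp_power_dvd)
  qed
  then have "fps_X ^ Suc n dvd (\<Sum>s=1..n. shanks_term n s)"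
    by (rule dvd_sum)
  then obtain R where R: "(\<Sum>s=1..n. shanks_term n s) = fps_X ^ Suc n * R" ..
  have "pentagonal_sum n = shanks_term n 0 + (\<Sum>s=1..n. shanks_term n s)"
    by (simp add: sum.atLeast_Suc_atMost atMost_atLeast0 flip: shanks_identity)
  also have "\<dots> = (\<Prod>k=1..n. 1 - fps_X ^ k) + fps_X ^ Suc n * R"
    by (simp only: R) (simp add: shanks_term_def)
  finally have "partition_fps n * pentagonal_sum n =
      partition_fps n * (\<Prod>k=1..n. 1 - fps_X ^ k) + fps_X ^ Suc n * (R * partition_fps n)"
    by (simp add: algebra_simps)
  then have "partition_fps n * pentagonal_sum n = 1 + fps_X ^ Suc n * (R * partition_fps n)"
    by (simp only: partition_fps_times_prod)
  then have "(partition_fps n * pentagonal_sum n) $ n = 0"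
    using assms by (simp add: fps_X_power_mult_nth del: power_Suc)
  moreover have "partition_fps n $ i = int (card (partitions_of i))" if "i \<le> n" for i
    using that by (simp add: partition_fps_def bounded_partitions_eq_partitions_of)
  ultimately show ?thesis
    by (simp add: fps_mult_nth atMost_atLeast0)
qed

section \<open>Odd partition numbers\<close>

lemma triangle_mono: "i \<le> j \<Longrightarrow> triangle i \<le> triangle j"
  by (induction rule: dec_induct) auto

lemma pentagonal_sum_nth:
  assumes "m > 0"
  shows "pentagonal_sum n $ m = (\<Sum>j=1..n. (-1) ^ j *
    ((if m = j * j + triangle j then 1 else 0) + (if m = j * j + triangle (j - 1) then 1 else 0)))"
proof -
  have "((-1) ^ j * f :: int fps) $ m = (-1) ^ j * f $ m" for j f
    by (cases "even j") auto
  then show ?thesis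
    using assms by (simp add: pentagonal_sum_def fps_sum_nth)
qed

lemma pentagonal_sum_nth_pentagonal:
  assumes "1 \<le> k" and "k \<le> n"
  shows "pentagonal_sum n $ (k * k + triangle k) = (-1) ^ k"
proof -
  let ?N = "k * k + triangle k"
  have "(-1) ^ j * ((if ?N = j * j + triangle j then 1 else 0) +
      (if ?N = j * j + triangle (j - 1) then 1 else 0)) = (if j = k then (-1) ^ k else (0::int))"
    if "j \<in> {1..n}" for j
  proof -
    consider "j < k" | "j = k" | "k < j" by linarith
    then show ?thesis
    proof cases
      case 1
      then have "j * j < k * k" "triangle j \<le> triangle k" "triangle (j - 1) \<le> triangle k"
        by (auto intro: mult_strict_mono triangle_mono)
      then show ?thesis using 1 by auto
    next
      \<comment> \<open>The two exponents belonging to k differ by k > 0, so only one of them equals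
        \<open>?N\<close>.\<close>
      case 2
      then obtain i where "k = Suc i" using assms by (cases k) auto
      then show ?thesis using 2 by auto
    next
      case 3
      then have "k * k < j * j" "triangle k \<le> triangle j" "triangle k \<le> triangle (j - 1)"
        by (auto intro: mult_strict_mono triangle_mono)
      then show ?thesis using 3 by auto
    qed
  qed
  then have "pentagonal_sum n $ ?N = (\<Sum>j=1..n. if j = k then (-1) ^ k else 0)"
    using assms by (subst pentagonal_sum_nth) (auto intro!: sum.cong)
  then show ?thesis
    using assms by simp
qed

text \<open>The other exponent with index k lies exactly k lower; indices below k give numbers at
  least 3k - 1 lower, since squares and triangles both shrink.\<close>

lemma pentagonal_gap:
  assumes "1 \<le> k" and "m < k * k + triangle k" and "pentagonal_sum n $ m \<noteq> 0"
  shows "m + k \<le> k * k + triangle k"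
proof (cases "m = 0")
  case True
  \<comment> \<open>The constant term makes 0 a pentagonal number too, and k <= k * k.\<close>
  then show ?thesis
    using assms(1) by (simp add: trans_le_add1)
next
  case False
  then obtain j where j: "1 \<le> j" "m = j * j + triangle j \<or> m = j * j + triangle (j - 1)"
    using assms(3) by (subst (asm) pentagonal_sum_nth) (auto elim!: sum.not_neutral_contains_not_neutral split: if_splits)
  obtain i where i: "k = Suc i"
    using assms(1) by (cases k) auto
  have "j \<le> k"
  proof (rule ccontr)
    assume "\<not> j \<le> k"
    then have "k * k \<le> j * j" "triangle k \<le> triangle j" "triangle k \<le> triangle (j - 1)"
      by (auto intro: mult_mono triangle_mono)
    then show False using j assms(2) by auto
  qed
  show ?thesis
  proof (cases "j = k")
    case True
    then show ?thesis using j assms(2) i by auto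
  next
    case False
    then have "j \<le> i" using \<open>j \<le> k\<close> i by simp
    then have "j * j \<le> i * i" "triangle j \<le> triangle i" "triangle (j - 1) \<le> triangle i"
      by (auto intro: mult_mono triangle_mono)
    then show ?thesis using j i by auto
  qed
qed

lemma partitions_of_0: "partitions_of 0 = {{#}}"
  using bounded_partitions_eq_partitions_of[of 0 0] by (simp add: bounded_partitions_0)

lemma ex_odd_card_partitions_of:
  assumes "1 \<le> k"
  obtains i where "k \<le> i" and "i \<le> k * k + triangle k" and "odd (card (partitions_of i))"
proof -
  define N where "N = k * k + triangle k"
  have N: "0 < N" "k \<le> N"
    using assms by (auto simp: N_def intro: trans_le_add1)
  let ?t = "\<lambda>i. int (card (partitions_of i)) * pentagonal_sum N $ (N - i)"
  have "?t 0 + (\<Sum>i=1..N. ?t i) = 0"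
    using pentagonal_recurrence[OF N(1)] by (simp add: sum.atLeast_Suc_atMost atMost_atLeast0)
  moreover have "odd (?t 0)"
    using pentagonal_sum_nth_pentagonal[OF assms, of N] N by (simp add: partitions_of_0 flip: N_def)
  ultimately have "odd (\<Sum>i=1..N. ?t i)"
    by (metis even_zero odd_add)
  then obtain i where i: "i \<in> {1..N}" "odd (?t i)"
    by (meson dvd_sum)
  \<comment> \<open>An odd summand has a nonzero pentagonal coefficient, so the gap below N applies
    to N - i.\<close>
  then have "pentagonal_sum N $ (N - i) \<noteq> 0"
    by auto
  moreover have "N - i < N"
    using i N by auto
  ultimately have "N - i + k \<le> N"
    using pentagonal_gap[OF assms] by (simp add: N_def)
  then have "k \<le> i"
    using i by auto
  then show thesis
    using i that by (auto simp: N_def)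
qed

lemma odd_sigma_moex_iff: "odd (sigma_moex n) \<longleftrightarrow> odd (card (partitions_of n))"
proof -
  have "{\<pi> \<in> partitions_of n. odd (moex \<pi>)} = partitions_of n"
    using moex_correct by blast
  then show ?thesis
    by (simp add: sigma_moex_def even_sum_iff finite_partitions_of)
qed

section \<open>Counting\<close>

lemma triangle_le_square: "triangle k \<le> k * k"
  by (induction k) auto

text \<open>With k = \<open>2 ^ 4 ^ i\<close> the next endpoint is k^4, which exceeds k * k +
  \<open>triangle k\<close> <= 2k^2 because k >= 2.\<close>

lemma ex_odd_sigma_moex_tower:
  obtains n where "2 ^ 4 ^ i \<le> n" and "n < 2 ^ 4 ^ Suc i" and "odd (sigma_moex n)"
proof -
  let ?k = "2 ^ 4 ^ i :: nat"
  have k: "2 \<le> ?k"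
    using power_increasing[of 1 "4 ^ i" "2::nat"] by simp
  then have "1 \<le> ?k"
    by linarith
  then obtain n where n: "?k \<le> n" "n \<le> ?k * ?k + triangle ?k" "odd (card (partitions_of n))"
    by (rule ex_odd_card_partitions_of)
  have "4 \<le> ?k * ?k"
    using mult_mono[OF k k] by simp
  have "n \<le> 2 * (?k * ?k)"
    using n(2) triangle_le_square[of ?k] by linarith
  also have "\<dots> < 4 * (?k * ?k)"
    by simp
  also have "\<dots> \<le> (?k * ?k) * (?k * ?k)"
    using \<open>4 \<le> ?k * ?k\<close> by (rule mult_right_mono) simp
  also have "\<dots> = 2 ^ 4 ^ Suc i"
    by (simp flip: power_add)
  finally show thesis
    using n that odd_sigma_moex_iff by blast
qed

lemma card_odd_sigma_moex_ge:
  assumes "2 ^ 4 ^ M \<le> X"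
  shows "M \<le> card {n. 1 \<le> n \<and> real n \<le> X \<and> odd (sigma_moex n)}" (is "_ \<le> card ?S")
proof -
  have "\<exists>n. 2 ^ 4 ^ i \<le> n \<and> n < 2 ^ 4 ^ Suc i \<and> odd (sigma_moex n)" for i
    using ex_odd_sigma_moex_tower by metis
  then obtain f where f: "\<And>i. 2 ^ 4 ^ i \<le> f i" "\<And>i. f i < 2 ^ 4 ^ Suc i"
      "\<And>i. odd (sigma_moex (f i))"
    by metis
  have "strict_mono f"
    unfolding strict_mono_Suc_iff using f(1,2) by (meson order_less_le_trans)
  have "f ` {..<M} \<subseteq> ?S"
  proof safe
    fix i assume "i < M"
    have "f i < 2 ^ 4 ^ Suc i"
      by (rule f)
    also have "(2::nat) ^ 4 ^ Suc i \<le> 2 ^ 4 ^ M"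
      using \<open>i < M\<close> by (intro power_increasing) auto
    finally have "real (f i) < 2 ^ 4 ^ M"
      by (metis of_nat_less_iff of_nat_numeral of_nat_power)
    then show "real (f i) \<le> X"
      using assms by linarith
    show "1 \<le> f i"
      using f(1)[of i] one_le_power[of "2::nat" "4 ^ i"] by linarith
    assume "even (sigma_moex (f i))"
    then show False using f(3) by blast
  qed
  \<comment> \<open>An infinite set would have \<open>card\<close> 0, so monotonicity needs
    this.\<close>
  moreover have "finite ?S"
    by (rule finite_subset[of _ "{..nat \<lfloor>X\<rfloor>}"]) (auto simp: le_nat_floor)
  ultimately have "card (f ` {..<M}) \<le> card ?S"
    by (rule card_mono[rotated])
  moreover have "inj_on f {..<M}"
    using \<open>strict_mono f\<close> strict_mono_imp_inj_on inj_on_subset by blast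
  ultimately show ?thesis
    by (simp add: card_image)
qed

theorem theorem1p5:
  "\<exists>\<beta>::real. \<beta> > 0 \<and>
     (\<forall>\<^sub>F X::real in at_top.
        real (card {n::nat. 1 \<le> n \<and> real n \<le> X \<and> odd (sigma_moex n)}) \<ge> \<beta> * ln (ln X))"
proof (intro exI conjI)
  \<comment> \<open>With L = ln (ln X), about L/2 intervals fit below X, and L/2 - 1 >= L/4 once L
    >= 4, that is, X >= exp (exp 4).\<close>
  show "(1 / 4 :: real) > 0" by simp
  show "\<forall>\<^sub>F X::real in at_top.
      real (card {n::nat. 1 \<le> n \<and> real n \<le> X \<and> odd (sigma_moex n)}) \<ge> 1 / 4 * ln (ln X)"
    using eventually_ge_at_top[of "exp (exp 4)"]
  proof eventually_elim
    case (elim X)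
    have X: "0 < X"
      using elim exp_gt_zero[of "exp 4"] by linarith
    have lnX: "exp 4 \<le> ln X"
      using elim X by (simp add: ln_ge_iff)
    then have pos: "0 < ln X"
      using exp_gt_zero[of "4::real"] by linarith
    then have ln_ln: "4 \<le> ln (ln X)"
      using lnX by (simp add: ln_ge_iff)
    \<comment> \<open>Halving absorbs the bases: 4 <= exp 2 gives 4^M <= exp (2M) <= ln X, and 2 <=
      exp 1 then gives \<open>2 ^ 4 ^ M\<close> <= X.\<close>
    define M where "M = nat \<lfloor>ln (ln X) / 2\<rfloor>"
    have M: "real M \<le> ln (ln X) / 2" "ln (ln X) / 2 - 1 \<le> real M"
      using ln_ln unfolding M_def by linarith+
    have exp1: "(2::real) \<le> exp 1"
      using exp_ge_add_one_self[of 1] by simp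
    then have "(4::real) \<le> exp 2"
      using mult_mono[OF exp1 exp1] by (simp flip: exp_add)
    then have "(4::real) ^ M \<le> exp 2 ^ M"
      by (rule power_mono) simp
    also have "\<dots> = exp (2 * real M)"
      by (simp add: exp_of_nat_mult[symmetric] mult.commute)
    also have "\<dots> \<le> exp (ln (ln X))"
      using M(1) by simp
    also have "\<dots> = ln X"
      using pos by simp
    finally have "4 ^ M \<le> ln X" .
    have "(2::real) ^ 4 ^ M \<le> exp 1 ^ 4 ^ M"
      using exp1 by (rule power_mono) simp
    also have "\<dots> = exp (4 ^ M)"
      by (simp add: exp_of_nat_mult[symmetric])
    also have "\<dots> \<le> exp (ln X)"
      using \<open>4 ^ M \<le> ln X\<close> by simp
    also have "\<dots> = X"
      using X by simp
    finally have "M \<le> card {n. 1 \<le> n \<and> real n \<le> X \<and> odd (sigma_moex n)}"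
      by (rule card_odd_sigma_moex_ge)
    then show ?case
      using M(2) ln_ln by linarith
  qed
qed

end
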